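(* For every $n \geq 3$, the set $\mathcal W_n$ does not contain any perfect lattices. Hence there are no extreme lattices in $\mathcal W_n$ for $n \geq 3$.
   Context: A lattice $L$ means a lattice of rank $n$ in $\mathbb R^n$. $\|\cdot\|$ is the Euclidean norm, $|L| = \min\{\|x\| : x\in L\setminus\{0\}\}$, and $S(L)=\{x\in L:\|x\|=|L|\}$ is the set of minimal vectors. $L$ is perfect if $\{xx^{\top}:x\in S(L)\}$ (vectors written as columns) spans the space of $n\times n$ real symmetric matrices. $L$ is extreme if it is a local maximum, on the space of lattices $\mathrm{GL}_n(\mathbb R)/\mathrm{GL}_n(\mathbb Z)$, of the packing density $\delta(L)=\frac{\omega_n|L|^n}{2^n\det L}$, where $\omega_n$ is the volume of the unit ball in $\mathbb R^n$ and $\det L$ is the absolute value of the determinant of a basis matrix of $L$. $L$ is well-rounded (WR) if $\mathrm{span}_{\mathbb R}S(L)=\mathrm{span}_{\mathbb R}L$. For an ordered basis $\{b_1,\dots,b_n\}$ of $L$, let $\theta_i\in(0,\pi/2]$ ($1\le i\le n-1$) be the angle between $b_{i+1}$ and the subspace $\mathrm{span}_{\mathbb R}\{b_1,\dots,b_i\}$. The ordered basis is weakly nearly orthogonal if $\theta_i\ge\pi/3$ for all $1\le i\le n-1$. Two lattices $L_1,L_2$ are similar if $L_2=\alpha U L_1$ with $\alpha>0$ and $U$ real orthogonal. $\mathcal W_n$ is the set of similarity classes of WR lattices in $\mathbb R^n$ that have a weakly nearly orthogonal basis. Perfection and extremality are invariant under similarity. *)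

theory Defs
  imports "HOL-Analysis.Analysis"
begin

section \<open>Lattices of full rank\<close>

text \<open>The columns of the matrix are the basis vectors.\<close>

definition lattice_of :: "real^'n^'n \<Rightarrow> (real^'n) set" where
  "lattice_of B = (\<lambda>x. B *v x) ` {x. \<forall>i. x $ i \<in> \<int>}"

definition GL :: "(real^'n^'n) set" where
  "GL = {B. invertible B}"

definition lattices :: "(real^'n) set set" where
  "lattices = lattice_of ` GL"

definition lattice_det :: "(real^'n) set \<Rightarrow> real" where
  "lattice_det L = (THE d. \<exists>B\<in>GL. lattice_of B = L \<and> d = \<bar>det B\<bar>)"

definition min_norm :: "(real^'n) set \<Rightarrow> real" where
  "min_norm L = (LEAST r. r \<in> norm ` (L - {0}))"

definition min_vectors :: "(real^'n) set \<Rightarrow> (real^'n) set" where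
  "min_vectors L = {x \<in> L. norm x = min_norm L}"

definition well_rounded :: "(real^'n) set \<Rightarrow> bool" where
  "well_rounded L \<longleftrightarrow> span (min_vectors L) = span L"

definition outer_square :: "real^'n \<Rightarrow> real^'n^'n" where
  "outer_square x = (\<chi> i j. x $ i * x $ j)"

definition perfect :: "(real^'n) set \<Rightarrow> bool" where
  "perfect L \<longleftrightarrow> span (outer_square ` min_vectors L) = {A. transpose A = A}"

section \<open>The space of lattices and extreme lattices\<close>

text \<open>The group \<open>GL\<^sub>n(\<int>)\<close> acts on basis matrices from the right, and its orbits are
  the fibres of \<^const>\<open>lattice_of\<close> (lemma \<open>lattice_of_eq_iff\<close>). So the quotient
  \<open>GL\<^sub>n(\<real>) / GL\<^sub>n(\<int>)\<close> is the set of lattices with the quotient topology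
  induced by \<^const>\<open>lattice_of\<close>.\<close>

definition GLZ :: "(real^'n^'n) set" where
  "GLZ = {U. (\<forall>i j. U $ i $ j \<in> \<int>) \<and> (\<exists>V. (\<forall>i j. V $ i $ j \<in> \<int>) \<and> U ** V = mat 1)}"

definition lattice_space :: "(real^'n) set topology" where
  "lattice_space = topology (\<lambda>\<U>. \<U> \<subseteq> lattices \<and>
     openin (top_of_set GL) {B \<in> GL. lattice_of B \<in> \<U>})"

definition packing_density :: "(real^'n) set \<Rightarrow> real" where
  "packing_density L =
     measure lebesgue (ball (0 :: real^'n) 1) * min_norm L ^ CARD('n) / (2 ^ CARD('n) * lattice_det L)"

definition extreme :: "(real^'n) set \<Rightarrow> bool" where
  "extreme L \<longleftrightarrow>
     (\<exists>\<U>. openin lattice_space \<U> \<and> L \<in> \<U> \<and> (\<forall>M\<in>\<U>. packing_density M \<le> packing_density L))"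

section \<open>Weakly nearly orthogonal bases\<close>

text \<open>Ordered bases are indexed by \<open>1, \<dots>, n\<close>; values outside this range are irrelevant.\<close>

definition ordered_basis :: "(nat \<Rightarrow> real^'n) \<Rightarrow> (real^'n) set \<Rightarrow> bool" where
  "ordered_basis b L \<longleftrightarrow>
     inj_on b {1..CARD('n)} \<and> independent (b ` {1..CARD('n)}) \<and>
     L = {(\<Sum>i=1..CARD('n). of_int (c i) *\<^sub>R b i) | c. True}"

definition vector_angle :: "real^'n \<Rightarrow> real^'n \<Rightarrow> real" where
  "vector_angle u v = arccos (u \<bullet> v / (norm u * norm v))"

text \<open>The smallest angle between \<open>v\<close> and a nonzero vector of \<open>V\<close>. It is at most
  \<open>\<pi>/2\<close> because \<open>V\<close> is closed under negation.\<close>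

definition subspace_angle :: "real^'n \<Rightarrow> (real^'n) set \<Rightarrow> real" where
  "subspace_angle v V = (INF u\<in>V - {0}. vector_angle v u)"

definition weakly_nearly_orthogonal :: "(nat \<Rightarrow> real^'n) \<Rightarrow> bool" where
  "weakly_nearly_orthogonal b \<longleftrightarrow>
     (\<forall>i\<in>{1..CARD('n) - 1}. subspace_angle (b (i + 1)) (span (b ` {1..i})) \<ge> pi / 3)"

section \<open>Similarity classes\<close>

definition similarity :: "((real^'n) set \<times> (real^'n) set) set" where
  "similarity = {(L, M). L \<in> lattices \<and> M \<in> lattices \<and>
     (\<exists>\<alpha> U. \<alpha> > 0 \<and> orthogonal_matrix U \<and> M = (\<lambda>x. \<alpha> *\<^sub>R (U *v x)) ` L)}"

definition WR_classes :: "(real^'n) set set set" where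
  "WR_classes =
     {L \<in> lattices. well_rounded L \<and> (\<exists>b. ordered_basis b L \<and> weakly_nearly_orthogonal b)} // similarity"

section \<open>Well-definedness\<close>

lemma istopology_lattice_space:
  "istopology (\<lambda>\<U>. \<U> \<subseteq> lattices \<and> openin (top_of_set GL) {B \<in> GL :: (real^'n^'n) set. lattice_of B \<in> \<U>})"
proof -
  have "{B \<in> GL. lattice_of B \<in> S \<inter> T} =
      {B \<in> GL. lattice_of B \<in> S} \<inter> {B \<in> GL. lattice_of B \<in> T}" for S T :: "(real^'n) set set"
    by blast
  moreover have "{B \<in> GL. lattice_of B \<in> \<Union>\<K>} = (\<Union>S\<in>\<K>. {B \<in> GL. lattice_of B \<in> S})"
    for \<K> :: "(real^'n) set set set"
    by blast
  ultimately show ?thesis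
    unfolding istopology_def by (auto intro!: openin_Int openin_clauses(3))
qed

lemma openin_lattice_space:
  "openin lattice_space \<U> \<longleftrightarrow>
     \<U> \<subseteq> lattices \<and> openin (top_of_set GL) {B \<in> GL. lattice_of B \<in> \<U>}"
  unfolding lattice_space_def by (simp add: topology_inverse'[OF istopology_lattice_space])

lemma topspace_lattice_space: "topspace lattice_space = (lattices :: (real^'n) set set)"
proof -
  have "{B \<in> GL. lattice_of B \<in> (lattices :: (real^'n) set set)} = GL"
    by (auto simp: lattices_def)
  moreover have "openin (top_of_set GL) (GL :: (real^'n^'n) set)"
    by simp
  ultimately have "openin lattice_space (lattices :: (real^'n) set set)"
    by (simp add: openin_lattice_space)
  then show ?thesis
    using openin_lattice_space[of "topspace lattice_space :: (real^'n) set set"]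
      openin_subset[of lattice_space "lattices :: (real^'n) set set"]
    by (intro subset_antisym) auto
qed

lemma quotient_map_lattice_of: "quotient_map (top_of_set GL) lattice_space lattice_of"
  unfolding quotient_map_def by (auto simp: topspace_lattice_space openin_lattice_space lattices_def)

lemma matrix_mult_Ints:
  fixes U :: "real^'n^'n"
  assumes "\<forall>i j. U $ i $ j \<in> \<int>" "\<forall>i. x $ i \<in> \<int>"
  shows "\<forall>i. (U *v x) $ i \<in> \<int>"
  using assms by (auto simp: matrix_vector_mult_def intro!: Ints_sum Ints_mult)

lemma lattice_of_subset_imp:
  fixes B C :: "real^'n^'n"
  assumes "lattice_of C \<subseteq> lattice_of B"
  shows "\<exists>U. (\<forall>i j. U $ i $ j \<in> \<int>) \<and> C = B ** U"
proof -
  have "\<exists>x. (\<forall>i. x $ i \<in> \<int>) \<and> column j C = B *v x" for j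
  proof -
    have "C *v axis j 1 \<in> lattice_of C"
      by (auto simp: lattice_of_def axis_def)
    then have "C *v axis j 1 \<in> lattice_of B"
      using assms by blast
    then show ?thesis
      by (auto simp: lattice_of_def matrix_vector_mult_basis)
  qed
  then obtain f where f: "\<And>j i. f j $ i \<in> \<int>" "\<And>j. column j C = B *v f j"
    by metis
  have "C = B ** (\<chi> i j. f j $ i)"
    using f(2) by (auto simp: vec_eq_iff column_def matrix_matrix_mult_def matrix_vector_mult_def)
  then show ?thesis
    using f(1) by (intro exI[of _ "\<chi> i j. f j $ i"]) auto
qed

lemma lattice_of_mult_subset:
  fixes B U :: "real^'n^'n"
  assumes "\<forall>i j. U $ i $ j \<in> \<int>"
  shows "lattice_of (B ** U) \<subseteq> lattice_of B"
  using matrix_mult_Ints[OF assms]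
  by (auto simp: lattice_of_def matrix_vector_mul_assoc[symmetric])

lemma lattice_of_eq_iff:
  fixes B C :: "real^'n^'n"
  assumes "B \<in> GL"
  shows "lattice_of B = lattice_of C \<longleftrightarrow> (\<exists>U\<in>GLZ. C = B ** U)"
proof
  assume eq: "lattice_of B = lattice_of C"
  obtain U where U: "\<forall>i j. U $ i $ j \<in> \<int>" "C = B ** U"
    using lattice_of_subset_imp[OF equalityD2[OF eq]] by blast
  obtain V where V: "\<forall>i j. V $ i $ j \<in> \<int>" "B = C ** V"
    using lattice_of_subset_imp[OF equalityD1[OF eq]] by blast
  obtain D where D: "D ** B = mat 1"
    using assms by (auto simp: GL_def invertible_def)
  have "U ** V = (D ** B) ** (U ** V)"
    by (simp add: D)
  also have "\<dots> = D ** ((B ** U) ** V)"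
    by (simp add: matrix_mul_assoc)
  also have "\<dots> = mat 1"
    using U(2) V(2) D by simp
  finally show "\<exists>U\<in>GLZ. C = B ** U"
    using U V by (auto simp: GLZ_def)
next
  assume "\<exists>U\<in>GLZ. C = B ** U"
  then obtain U V where UV: "\<forall>i j. U $ i $ j \<in> \<int>" "\<forall>i j. V $ i $ j \<in> \<int>"
      "U ** V = mat 1" "C = B ** U"
    by (auto simp: GLZ_def)
  have "C ** V = B"
    using UV by (simp flip: matrix_mul_assoc)
  then show "lattice_of B = lattice_of C"
    using lattice_of_mult_subset[OF UV(1), of B] lattice_of_mult_subset[OF UV(2), of C] UV(4)
    by (intro subset_antisym) simp_all
qed

lemma det_Ints:
  fixes U :: "real^'n^'n"
  assumes "\<forall>i j. U $ i $ j \<in> \<int>"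
  shows "det U \<in> \<int>"
  using assms by (auto simp: det_def intro!: Ints_sum Ints_mult Ints_prod)

lemma abs_det_GLZ:
  fixes U :: "real^'n^'n"
  assumes "U \<in> GLZ"
  shows "\<bar>det U\<bar> = 1"
proof -
  obtain V where V: "\<forall>i j. V $ i $ j \<in> \<int>" "U ** V = mat 1"
    using assms by (auto simp: GLZ_def)
  obtain p q :: int where pq: "det U = of_int p" "det V = of_int q"
  proof -
    have "det U \<in> \<int>"
      using assms by (intro det_Ints) (simp add: GLZ_def)
    then show ?thesis
      using det_Ints[OF V(1)] that by (elim Ints_cases)
  qed
  have "det U * det V = 1"
    using V by (metis det_I det_mul)
  then have "of_int (p * q) = (1 :: real)"
    by (simp add: pq)
  then have "p * q = 1"
    by linarith
  then have "\<bar>p\<bar> = 1"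
    by (metis dvd_triv_left zdvd1_eq)
  then show ?thesis
    by (simp add: pq flip: of_int_abs)
qed

lemma lattice_det_lattice_of:
  fixes B :: "real^'n^'n"
  assumes "B \<in> GL"
  shows "lattice_det (lattice_of B) = \<bar>det B\<bar>"
  unfolding lattice_det_def
proof (rule the_equality)
  fix d assume "\<exists>C\<in>GL. lattice_of C = lattice_of B \<and> d = \<bar>det C\<bar>"
  then obtain C where C: "lattice_of B = lattice_of C" "d = \<bar>det C\<bar>"
    by auto
  then obtain U where "U \<in> GLZ" "C = B ** U"
    using lattice_of_eq_iff[OF assms] by blast
  then show "d = \<bar>det B\<bar>"
    using abs_det_GLZ[of U] by (simp add: C det_mul abs_mult)
qed (use assms in blast)

lemma equiv_similarity: "equiv lattices similarity"
proof (rule equivI)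
  show "similarity \<subseteq> lattices \<times> lattices"
    by (auto simp: similarity_def)
  show "refl_on lattices similarity"
    by (auto simp: refl_on_def similarity_def intro!: exI[of _ "1::real"] exI[of _ "mat 1"]
        simp: orthogonal_matrix_id)
  show "sym similarity"
  proof (rule symI)
    fix L M :: "(real^'n) set" assume LM: "(L, M) \<in> similarity"
    then obtain \<alpha> :: real and U :: "real^'n^'n"
      where U: "\<alpha> > 0" "orthogonal_matrix U" "M = (\<lambda>x. \<alpha> *\<^sub>R (U *v x)) ` L"
      by (auto simp: similarity_def)
    have "inverse \<alpha> *\<^sub>R (transpose U *v (\<alpha> *\<^sub>R (U *v x))) = x" for x
    proof -
      have "transpose U *v (U *v x) = x"
        using U(2) by (simp add: matrix_vector_mul_assoc orthogonal_matrix_def)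
      then show ?thesis
        using U(1) by (simp add: matrix_vector_mult_scaleR)
    qed
    then have "L = (\<lambda>x. inverse \<alpha> *\<^sub>R (transpose U *v x)) ` M"
      unfolding U(3) image_image by simp
    moreover have "inverse \<alpha> > 0" "orthogonal_matrix (transpose U)"
      using U by (simp_all add: orthogonal_matrix_transpose)
    ultimately show "(M, L) \<in> similarity"
      using LM unfolding similarity_def mem_Collect_eq case_prod_conv by blast
  qed
  show "trans similarity"
  proof (rule transI)
    fix L M N :: "(real^'n) set" assume *: "(L, M) \<in> similarity" "(M, N) \<in> similarity"
    then obtain \<alpha> \<beta> :: real and U V :: "real^'n^'n"
      where U: "\<alpha> > 0" "orthogonal_matrix U" "M = (\<lambda>x. \<alpha> *\<^sub>R (U *v x)) ` L"
        and V: "\<beta> > 0" "orthogonal_matrix V" "N = (\<lambda>x. \<beta> *\<^sub>R (V *v x)) ` M"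
      by (auto simp: similarity_def)
    have "N = (\<lambda>x. (\<beta> * \<alpha>) *\<^sub>R ((V ** U) *v x)) ` L"
      unfolding V(3) U(3) image_image
      by (simp add: matrix_vector_mult_scaleR matrix_vector_mul_assoc)
    moreover have "\<beta> * \<alpha> > 0" "orthogonal_matrix (V ** U)"
      using U V by (simp_all add: orthogonal_matrix_mul)
    ultimately show "(L, N) \<in> similarity"
      using * unfolding similarity_def mem_Collect_eq case_prod_conv by blast
  qed
qed

end

theory Submission
  imports Defs
begin

text \<open>Let \<open>V\<close> be the span of all basis vectors but the last one, \<open>b\<^sub>n\<close>. The angle condition
  forces every minimal vector outside \<open>V\<close> to be \<open>\<plusminus>b\<^sub>n\<close> or the sum of \<open>\<plusminus>b\<^sub>n\<close> and \<open>\<minusplus>2\<close> times the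
  projection of \<open>b\<^sub>n\<close> to \<open>V\<close>. As \<open>dim V \<ge> 2\<close>, there is a unit vector \<open>q \<in> V\<close> orthogonal to
  \<open>b\<^sub>n\<close>; let \<open>e\<close> be a unit normal of \<open>V\<close>. Then \<open>(e \<bullet> x) (q \<bullet> x) = 0\<close> for all minimal \<open>x\<close>, so the
  symmetric matrix \<open>e q\<^sup>T + q e\<^sup>T\<close> is orthogonal to all \<open>x x\<^sup>T\<close> and the lattice is not perfect.
  Nor is it extreme: tilting \<open>e\<close> by a small angle \<open>t > 0\<close> towards \<open>q\<close>, with the hyperplane
  \<open>e\<^sup>\<bottom> = V\<close> kept fixed, changes the square norm of \<open>x\<close> by \<open>2 sin t (e \<bullet> x) (q \<bullet> x)\<close>, so it
  preserves the length of the minimal vectors, while it multiplies the determinant by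
  \<open>cos t < 1\<close>.\<close>

section \<open>Minimal vectors\<close>

lemma finite_integer_vectors_norm_le:
  "finite {x :: real^'n. (\<forall>i. x $ i \<in> \<int>) \<and> norm x \<le> r}"
proof -
  let ?F = "{k :: real. k \<in> \<int> \<and> \<bar>k\<bar> \<le> r}"
  have "finite (vec_lambda ` (PiE (UNIV :: 'n set) (\<lambda>_. ?F)))"
    by (intro finite_imageI finite_PiE finite_abs_int_segment) simp
  moreover have "{x :: real^'n. (\<forall>i. x $ i \<in> \<int>) \<and> norm x \<le> r}
      \<subseteq> vec_lambda ` (PiE (UNIV :: 'n set) (\<lambda>_. ?F))"
  proof
    fix x :: "real^'n" assume x: "x \<in> {x. (\<forall>i. x $ i \<in> \<int>) \<and> norm x \<le> r}"
    then have "vec_nth x \<in> PiE UNIV (\<lambda>_. ?F)"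
      using component_le_norm_cart[of x] by (auto intro: order_trans)
    then show "x \<in> vec_lambda ` (PiE (UNIV :: 'n set) (\<lambda>_. ?F))"
      by (metis image_eqI vec_nth_inverse)
  qed
  ultimately show ?thesis
    by (rule finite_subset[rotated])
qed

lemma inj_matrix_GL: "B \<in> GL \<Longrightarrow> inj ((*v) B)"
  by (auto simp: GL_def invertible_def simp flip: matrix_left_invertible_injective)

lemma finite_lattice_norm_le:
  assumes "L \<in> lattices"
  shows "finite {x \<in> L. norm x \<le> r}"
proof -
  obtain B where B: "B \<in> GL" "L = lattice_of B"
    using assms by (auto simp: lattices_def)
  \<comment> \<open>An injective linear map is bounded below, so bounded lattice vectors have
    bounded integer coordinates.\<close>
  obtain C where C: "C > 0" "\<And>x. C * norm x \<le> norm (B *v x)"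
    using linear_inj_bounded_below_pos[OF matrix_vector_mul_linear inj_matrix_GL[OF B(1)]] by blast
  have "{x \<in> L. norm x \<le> r} \<subseteq> (*v) B ` {x. (\<forall>i. x $ i \<in> \<int>) \<and> norm x \<le> r / C}"
  proof
    fix x assume "x \<in> {x \<in> L. norm x \<le> r}"
    then obtain y where y: "x = B *v y" "\<forall>i. y $ i \<in> \<int>" "norm (B *v y) \<le> r"
      by (auto simp: B(2) lattice_of_def)
    have "norm y \<le> r / C"
      using C(1) order_trans[OF C(2) y(3)] by (simp add: field_simps)
    with y show "x \<in> (*v) B ` {x. (\<forall>i. x $ i \<in> \<int>) \<and> norm x \<le> r / C}"
      by blast
  qed
  then show ?thesis
    by (rule finite_subset) (intro finite_imageI finite_integer_vectors_norm_le)
qed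

text \<open>\<open>LEAST\<close> over the reals is informative only if the minimum is attained. It
  is, because only finitely many lattice vectors are at most as long as a given nonzero one.\<close>

lemma
  assumes "L \<in> lattices"
  shows min_norm_attained: "\<exists>x\<in>L. x \<noteq> 0 \<and> norm x = min_norm L"
    and min_norm_le: "\<And>x. x \<in> L \<Longrightarrow> x \<noteq> 0 \<Longrightarrow> min_norm L \<le> norm x"
    and min_norm_pos: "min_norm L > 0"
proof -
  obtain B where B: "B \<in> GL" "L = lattice_of B"
    using assms by (auto simp: lattices_def)
  have "B *v axis undefined 1 \<noteq> 0"
    using injD[OF inj_matrix_GL[OF B(1)], of "axis undefined 1" 0] by auto
  moreover have "B *v axis undefined 1 \<in> L"
    by (auto simp: B(2) lattice_of_def axis_def)
  ultimately obtain x0 where x0: "x0 \<in> L" "x0 \<noteq> 0"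
    by blast
  define F where "F = {x \<in> L. norm x \<le> norm x0} - {0}"
  have F: "finite (norm ` F)" "norm ` F \<noteq> {}"
    using finite_lattice_norm_le[OF assms, of "norm x0"] x0 by (auto simp: F_def)
  have le: "Min (norm ` F) \<le> norm x" if "x \<in> L" "x \<noteq> 0" for x
  proof (cases "norm x \<le> norm x0")
    case True
    then show ?thesis
      using that F by (intro Min_le) (auto simp: F_def)
  next
    case False
    moreover have "Min (norm ` F) \<le> norm x0"
      using x0 F by (intro Min_le) (auto simp: F_def)
    ultimately show ?thesis
      by simp
  qed
  have mem: "Min (norm ` F) \<in> norm ` F"
    using F by (rule Min_in)
  have eq: "min_norm L = Min (norm ` F)"
    unfolding min_norm_def using le mem by (intro Least_equality) (auto simp: F_def)
  show att: "\<exists>x\<in>L. x \<noteq> 0 \<and> norm x = min_norm L"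
    using mem unfolding eq by (auto simp: F_def)
  show "min_norm L > 0"
    using att by (metis zero_less_norm_iff)
  show "\<And>x. x \<in> L \<Longrightarrow> x \<noteq> 0 \<Longrightarrow> min_norm L \<le> norm x"
    using le eq by simp
qed

text \<open>Free of \<open>min_norm\<close>, so that minimality can be moved along a similarity by
  comparing norms only.\<close>

lemma min_vectors_iff:
  assumes "L \<in> lattices"
  shows "x \<in> min_vectors L \<longleftrightarrow> x \<in> L \<and> x \<noteq> 0 \<and> (\<forall>y\<in>L. y \<noteq> 0 \<longrightarrow> norm x \<le> norm y)"
  using min_norm_attained[OF assms] min_norm_le[OF assms] min_norm_pos[OF assms]
  unfolding min_vectors_def by (force intro: antisym)

section \<open>Lattices whose minimal vectors lie in two orthogonal hyperplanes\<close>

text \<open>The common obstruction to perfection and extremality: the quadratic form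
  \<open>(e \<bullet> x) * (q \<bullet> x)\<close> vanishes on all minimal vectors.\<close>

definition hyperplane_cover :: "real^'n \<Rightarrow> real^'n \<Rightarrow> (real^'n) set \<Rightarrow> bool" where
  "hyperplane_cover e q L \<longleftrightarrow> norm e = 1 \<and> norm q = 1 \<and> e \<bullet> q = 0 \<and>
     (\<forall>x\<in>min_vectors L. e \<bullet> x = 0 \<or> q \<bullet> x = 0)"

text \<open>A member of a class in \<open>WR_classes\<close> is only known to be similar to a
  lattice with a suitable basis. The orthogonal part of the similarity carries both normals
  over.\<close>

lemma hyperplane_cover_similar:
  assumes "hyperplane_cover e q L" "(L, M) \<in> similarity"
  shows "\<exists>e q. hyperplane_cover e q M"
proof -
  obtain \<alpha> U where U: "\<alpha> > 0" "orthogonal_matrix U" "M = (\<lambda>x. \<alpha> *\<^sub>R (U *v x)) ` L"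
    and L: "L \<in> lattices" and M: "M \<in> lattices"
    using assms(2) by (auto simp: similarity_def)
  have "orthogonal_transformation ((*v) U)"
    using U(2) by (simp add: orthogonal_transformation_matrix)
  then have inner: "(U *v x) \<bullet> (U *v y) = x \<bullet> y" and norm: "norm (U *v x) = norm x" for x y
    by (auto simp: orthogonal_transformation_def norm_eq_sqrt_inner)
  have "e \<bullet> x = 0 \<or> q \<bullet> x = 0" if "\<alpha> *\<^sub>R (U *v x) \<in> min_vectors M" "x \<in> L" for x
  proof -
    have "norm x \<le> norm y" if "y \<in> L" "y \<noteq> 0" for y
    proof -
      have "\<alpha> *\<^sub>R (U *v y) \<in> M" "\<alpha> *\<^sub>R (U *v y) \<noteq> 0"
        using that U norm[of y] by auto
      then have "norm (\<alpha> *\<^sub>R (U *v x)) \<le> norm (\<alpha> *\<^sub>R (U *v y))"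
        using \<open>\<alpha> *\<^sub>R (U *v x) \<in> min_vectors M\<close> min_vectors_iff[OF M] by blast
      then show ?thesis
        using U(1) by (simp add: norm)
    qed
    moreover have "x \<noteq> 0"
      using that(1) by (auto simp: min_vectors_iff[OF M])
    ultimately have "x \<in> min_vectors L"
      using that(2) by (simp add: min_vectors_iff[OF L])
    then show ?thesis
      using assms(1) by (auto simp: hyperplane_cover_def)
  qed
  moreover have "min_vectors M \<subseteq> (\<lambda>x. \<alpha> *\<^sub>R (U *v x)) ` L"
    by (auto simp: min_vectors_def U(3))
  ultimately have "(U *v e) \<bullet> x = 0 \<or> (U *v q) \<bullet> x = 0" if "x \<in> min_vectors M" for x
    using that by (fastforce simp: inner)
  then have "hyperplane_cover (U *v e) (U *v q) M"
    using assms(1) by (simp add: hyperplane_cover_def inner norm)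
  then show ?thesis
    by blast
qed

section \<open>Failure of perfection\<close>

lemma hyperplane_cover_not_perfect:
  fixes L :: "(real^'n) set"
  assumes "hyperplane_cover e q L"
  shows "\<not> perfect L"
proof
  assume perf: "perfect L"
  define A :: "real^'n^'n" where "A = (\<chi> i j. e $ i * q $ j + q $ i * e $ j)"
  have form: "A \<bullet> outer_square x = 2 * (e \<bullet> x) * (q \<bullet> x)" for x
  proof -
    have "2 * (e \<bullet> x) * (q \<bullet> x) = (\<Sum>i\<in>UNIV. \<Sum>j\<in>UNIV. (e $ i * x $ i) * (q $ j * x $ j)) +
        (\<Sum>i\<in>UNIV. \<Sum>j\<in>UNIV. (q $ i * x $ i) * (e $ j * x $ j))"
      by (simp add: inner_vec_def flip: sum_product)
    then show ?thesis
      by (simp add: A_def outer_square_def inner_vec_def algebra_simps sum.distrib)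
  qed
  have "transpose A = A"
    by (simp add: A_def transpose_def vec_eq_iff)
  then have "A \<in> span (outer_square ` min_vectors L)"
    using perf by (simp add: perfect_def)
  \<comment> \<open>\<open>A\<close> lies in the span of matrices that are all orthogonal to
    it.\<close>
  then have "orthogonal A A"
    by (rule orthogonal_to_span)
      (use assms in \<open>auto simp: hyperplane_cover_def orthogonal_def form\<close>)
  then have "A = 0"
    by (simp add: orthogonal_def)
  \<comment> \<open>But \<open>A *v e = q\<close> since \<open>e\<close> and \<open>q\<close> are
    orthonormal, so this inner product is 1.\<close>
  then have "(A *v e) \<bullet> q = 0"
    by simp
  moreover have "A *v e = (q \<bullet> e) *\<^sub>R e + (e \<bullet> e) *\<^sub>R q"
    by (simp add: A_def matrix_vector_mult_def inner_vec_def vec_eq_iff algebra_simps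
        sum.distrib sum_distrib_left)
  ultimately show False
    using assms by (simp add: hyperplane_cover_def inner_commute inner_left_distrib norm_eq_1)
qed

section \<open>Rank-one updates of the identity\<close>

lemma rank_one_update_mult:
  fixes e w x :: "real^'n"
  shows "(\<chi> i j. (if i = j then 1 else 0) + w $ i * e $ j) *v x = x + (e \<bullet> x) *\<^sub>R w"
proof -
  have "(\<chi> i j. (if i = j then 1 else 0) + w $ i * e $ j) = mat 1 + (\<chi> i j. w $ i * e $ j)"
    by (simp add: vec_eq_iff mat_def)
  moreover have "(\<chi> i j. w $ i * e $ j) *v x = (e \<bullet> x) *\<^sub>R w"
    by (simp add: vec_eq_iff matrix_vector_mult_def inner_vec_def sum_distrib_left mult_ac)
  ultimately show ?thesis
    by (simp add: matrix_vector_mult_add_rdistrib)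
qed

text \<open>Conjugation by an orthogonal matrix that sends a coordinate vector to \<open>e\<close>
  leaves an identity matrix with one column replaced, whose determinant is given by Cramer's
  rule.\<close>

lemma det_rank_one_update:
  fixes e w :: "real^'n"
  assumes "norm e = 1"
  shows "det (\<chi> i j. (if i = j then 1 else 0) + w $ i * e $ j) = 1 + w \<bullet> e"
proof -
  define T :: "real^'n^'n" where "T = (\<chi> i j. (if i = j then 1 else 0) + w $ i * e $ j)"
  define k where "k = (undefined :: 'n)"
  obtain R where R: "orthogonal_matrix R" "R *v axis k 1 = e"
    using orthogonal_matrix_exists_basis[OF assms] by blast
  have R': "transpose R ** R = mat 1"
    using R(1) by (simp add: orthogonal_matrix_def)
  define u where "u = transpose R *v w"
  \<comment> \<open>The product with \<open>mat 1\<close> gives \<open>N\<close> the shape required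
    by \<open>cramer_lemma\<close>.\<close>
  define N :: "real^'n^'n"
    where "N = (\<chi> i j. if j = k then (mat 1 *v (axis k 1 + u)) $ i else mat 1 $ i $ j)"
  have uw: "u \<bullet> x = w \<bullet> (R *v x)" for x
    by (simp add: u_def dot_lmul_matrix flip: vector_transpose_matrix)
  have N: "N *v x = x + x $ k *\<^sub>R u" for x
  proof -
    have "N = (\<chi> i j. (if i = j then 1 else 0) + u $ i * axis k 1 $ j)"
      unfolding N_def vec_eq_iff matrix_vector_mul_lid by (simp add: mat_def axis_def)
    then show ?thesis
      by (simp only: rank_one_update_mult inner_axis') simp
  qed
  have T: "T *v x = x + (e \<bullet> x) *\<^sub>R w" for x
    by (simp only: T_def rank_one_update_mult)
  have "e \<bullet> (R *v x) = x $ k" for x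
  proof -
    have "e \<bullet> (R *v x) = (axis k 1 v* transpose R) \<bullet> (R *v x)"
      by (simp add: R(2))
    also have "\<dots> = axis k 1 \<bullet> ((transpose R ** R) *v x)"
      by (simp only: dot_lmul_matrix matrix_vector_mul_assoc)
    finally show ?thesis
      by (simp add: R' inner_axis')
  qed
  moreover have "transpose R *v (R *v x) = x" for x
    by (simp only: matrix_vector_mul_assoc R' matrix_vector_mul_lid)
  ultimately have "(transpose R ** T ** R) *v x = N *v x" for x
    by (simp only: N T u_def matrix_vector_mul_assoc[symmetric] matrix_vector_right_distrib
        matrix_vector_mult_scaleR)
  then have "transpose R ** T ** R = N"
    by (simp add: matrix_eq)
  then have "det N = det (transpose R ** R) * det T"
    by (metis (no_types, lifting) det_mul mult.assoc mult.commute)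
  then have "det T = det N"
    by (simp add: R')
  also have "\<dots> = 1 + u $ k"
    unfolding N_def cramer_lemma by simp
  also have "u $ k = w \<bullet> e"
    using uw[of "axis k 1"] by (simp add: R(2) inner_axis)
  finally show ?thesis
    by (simp add: T_def)
qed

text \<open>Fixes \<open>e\<^sup>\<bottom>\<close> pointwise and rotates \<open>e\<close> towards \<open>q\<close> by the angle \<open>t\<close>.\<close>

definition tilt :: "real^'n \<Rightarrow> real^'n \<Rightarrow> real \<Rightarrow> real^'n^'n" where
  "tilt e q t = (\<chi> i j. (if i = j then 1 else 0) + (sin t *\<^sub>R q + (cos t - 1) *\<^sub>R e) $ i * e $ j)"

lemma tilt_mult: "tilt e q t *v x = x + (e \<bullet> x) *\<^sub>R (sin t *\<^sub>R q + (cos t - 1) *\<^sub>R e)"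
  unfolding tilt_def by (rule rank_one_update_mult)

lemma det_tilt:
  assumes "norm e = 1" "e \<bullet> q = 0"
  shows "det (tilt e q t) = cos t"
  unfolding tilt_def using assms
  by (subst det_rank_one_update) (simp_all add: inner_add_left inner_commute[of q e] norm_eq_1)

lemma norm_tilt_square:
  assumes "norm e = 1" "norm q = 1" "e \<bullet> q = 0"
  shows "(norm (tilt e q t *v x))\<^sup>2 = (norm x)\<^sup>2 + 2 * sin t * ((e \<bullet> x) * (q \<bullet> x))"
proof -
  define a b where "a = e \<bullet> x" and "b = q \<bullet> x"
  have "(norm (tilt e q t *v x))\<^sup>2
      = x \<bullet> x + 2 * a * (sin t * b + (cos t - 1) * a) + a\<^sup>2 * ((sin t)\<^sup>2 + (cos t - 1)\<^sup>2)"
  proof -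
    have *: "(x + a *\<^sub>R (s *\<^sub>R q + d *\<^sub>R e)) \<bullet> (x + a *\<^sub>R (s *\<^sub>R q + d *\<^sub>R e))
        = x \<bullet> x + 2 * a * (s * (x \<bullet> q) + d * (x \<bullet> e))
          + a\<^sup>2 * (s\<^sup>2 * (q \<bullet> q) + 2 * s * d * (q \<bullet> e) + d\<^sup>2 * (e \<bullet> e))" for s d
      by (simp add: inner_commute power2_eq_square algebra_simps)
    have "e \<bullet> e = 1" "q \<bullet> q = 1" "q \<bullet> e = 0" "x \<bullet> e = a" "x \<bullet> q = b"
      using assms by (simp_all add: norm_eq_1 inner_commute a_def b_def)
    then show ?thesis
      unfolding tilt_mult power2_norm_eq_inner a_def[symmetric] * by simp
  qed
  \<comment> \<open>Times \<open>a\<^sup>2\<close>, this cancels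
    \<open>2 * (cos t - 1) * a\<^sup>2\<close>, leaving only the mixed term.\<close>
  also have "(sin t)\<^sup>2 + (cos t - 1)\<^sup>2 = 2 - 2 * cos t"
    using sin_cos_squared_add[of t] by (simp add: power2_diff)
  finally show ?thesis
    by (simp add: power2_norm_eq_inner[of x] a_def b_def algebra_simps power2_eq_square[of "_ \<bullet> _"])
qed

section \<open>Density gain under small tilts\<close>

lemma continuous_tilt: "continuous_on UNIV (\<lambda>t. tilt e q t ** B)"
  unfolding tilt_def matrix_matrix_mult_def by (simp, intro continuous_intros)

text \<open>One range of \<open>t\<close> must serve infinitely many \<open>x\<close>. Minimal
  vectors keep their length, the finitely many others of norm at most \<open>2 * m\<close> are
  handled by continuity, and longer ones by a uniform estimate.\<close>

lemma eventually_min_norm_le_tilt: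
  assumes "L \<in> lattices" "hyperplane_cover e q L"
  shows "\<forall>\<^sub>F t in at_right 0. \<forall>x\<in>L. x \<noteq> 0 \<longrightarrow> min_norm L \<le> norm (tilt e q t *v x)"
proof -
  define m where "m = min_norm L"
  have m: "m > 0"
    using min_norm_pos[OF assms(1)] by (simp add: m_def)
  have eq: "norm e = 1" "norm q = 1" "e \<bullet> q = 0"
    using assms(2) by (auto simp: hyperplane_cover_def)
  define F where "F = {x \<in> L. norm x \<le> 2 * m} - {0}"
  have lim: "((\<lambda>t. (norm x)\<^sup>2 + 2 * sin t * ((e \<bullet> x) * (q \<bullet> x))) \<longlongrightarrow>
      (norm x)\<^sup>2 + 2 * sin 0 * ((e \<bullet> x) * (q \<bullet> x))) (at_right 0)" for x
    by (intro tendsto_intros)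
  have "\<forall>\<^sub>F t in at_right 0. m\<^sup>2 \<le> (norm x)\<^sup>2 + 2 * sin t * ((e \<bullet> x) * (q \<bullet> x))" if "x \<in> F" for x
  proof (cases "norm x = m")
    case True
    then have "x \<in> min_vectors L"
      using that by (simp add: F_def min_vectors_def m_def)
    then have "(e \<bullet> x) * (q \<bullet> x) = 0"
      using assms(2) by (auto simp: hyperplane_cover_def)
    then show ?thesis
      using True by auto
  next
    case False
    then have "m < norm x"
      using that min_norm_le[OF assms(1), of x] by (simp add: F_def m_def)
    then have "m\<^sup>2 < (norm x)\<^sup>2"
      using m by (simp add: power_strict_mono)
    then show ?thesis
      using order_tendstoD(1)[OF lim, of "m\<^sup>2" x] by (auto elim: eventually_mono)
  qed
  moreover have "finite F"
    using finite_lattice_norm_le[OF assms(1)] by (simp add: F_def)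
  ultimately have ev1: "\<forall>\<^sub>F t in at_right 0. \<forall>x\<in>F. m\<^sup>2 \<le> (norm x)\<^sup>2 + 2 * sin t * ((e \<bullet> x) * (q \<bullet> x))"
    by (simp add: eventually_ball_finite)
  have "((\<lambda>t. \<bar>sin t\<bar> :: real) \<longlongrightarrow> \<bar>sin 0\<bar>) (at_right 0)"
    by (intro tendsto_intros)
  \<comment> \<open>With this bound the squared norm drops by at most half, which is harmless once
    it is at least \<open>4 * m\<^sup>2\<close>.\<close>
  then have ev2: "\<forall>\<^sub>F t in at_right 0. \<bar>sin t\<bar> < (1 / 4 :: real)"
    by (rule order_tendstoD) simp
  show ?thesis
    using ev1 ev2
  proof eventually_elim
    case (elim t)
    show ?case
    proof (intro ballI impI)
      fix x assume x: "x \<in> L" "x \<noteq> 0"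
      have "m\<^sup>2 \<le> (norm x)\<^sup>2 + 2 * sin t * ((e \<bullet> x) * (q \<bullet> x))"
      proof (cases "x \<in> F")
        case True
        then show ?thesis
          using elim by blast
      next
        case False
        then have "2 * m < norm x"
          using x by (auto simp: F_def)
        then have big: "(2 * m)\<^sup>2 \<le> (norm x)\<^sup>2"
          using m by (intro power_mono) auto
        have "\<bar>e \<bullet> x\<bar> \<le> norm x" "\<bar>q \<bullet> x\<bar> \<le> norm x"
          using Cauchy_Schwarz_ineq2[of e x] Cauchy_Schwarz_ineq2[of q x] eq by simp_all
        then have "\<bar>e \<bullet> x\<bar> * \<bar>q \<bullet> x\<bar> \<le> (norm x)\<^sup>2"
          unfolding power2_eq_square by (intro mult_mono) auto
        then have "\<bar>sin t\<bar> * (\<bar>e \<bullet> x\<bar> * \<bar>q \<bullet> x\<bar>) \<le> 1 / 4 * (norm x)\<^sup>2"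
          using elim(2) by (intro mult_mono) auto
        then have "\<bar>sin t * ((e \<bullet> x) * (q \<bullet> x))\<bar> \<le> 1 / 4 * (norm x)\<^sup>2"
          by (simp add: abs_mult)
        then show ?thesis
          using big by (simp add: power2_eq_square)
      qed
      then have "m\<^sup>2 \<le> (norm (tilt e q t *v x))\<^sup>2"
        by (simp add: norm_tilt_square[OF eq])
      then show "min_norm L \<le> norm (tilt e q t *v x)"
        using m by (simp add: m_def power2_le_iff_abs_le)
    qed
  qed
qed

lemma hyperplane_cover_not_extreme:
  fixes L :: "(real^'n) set"
  assumes "L \<in> lattices" "hyperplane_cover e q L"
  shows "\<not> extreme L"
proof
  assume "extreme L"
  then obtain \<U> where \<U>: "openin lattice_space \<U>" "L \<in> \<U>"
      "\<And>M. M \<in> \<U> \<Longrightarrow> packing_density M \<le> packing_density L"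
    by (auto simp: extreme_def)
  obtain B where B: "B \<in> GL" "L = lattice_of B"
    using assms by (auto simp: lattices_def)
  have eq: "norm e = 1" "norm q = 1" "e \<bullet> q = 0"
    using assms(2) by (auto simp: hyperplane_cover_def)
  \<comment> \<open>Openness in the quotient topology is openness of the set of basis matrices, so
    it suffices to move \<open>B\<close> slightly.\<close>
  obtain W where W: "open W" "{B \<in> GL. lattice_of B \<in> \<U>} = GL \<inter> W"
    using \<U>(1) by (auto simp: openin_lattice_space openin_open)
  have "tilt e q 0 = mat 1"
    by (simp add: tilt_def mat_def vec_eq_iff)
  moreover have "((\<lambda>t. tilt e q t ** B) \<longlongrightarrow> tilt e q 0 ** B) (at_right 0)"
    using continuous_tilt[of e q B] by (auto simp: continuous_on_def intro: tendsto_within_subset)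
  moreover have "B \<in> W"
    using W(2) B \<U>(2) by blast
  ultimately have evW: "\<forall>\<^sub>F t in at_right 0. tilt e q t ** B \<in> W"
    using W(1) by (simp add: topological_tendstoD)
  have evt: "\<forall>\<^sub>F t in at_right 0. 0 < t \<and> t < pi / 2"
    using eventually_at_right_real[of 0 "pi / 2"] by simp
  \<comment> \<open>The filter \<open>at_right 0\<close> is nontrivial, so a contradiction for all
    small \<open>t > 0\<close> suffices.\<close>
  have "\<forall>\<^sub>F t :: real in at_right 0. False"
    using eventually_min_norm_le_tilt[OF assms] evW evt
  proof eventually_elim
    case (elim t)
    define M where "M = lattice_of (tilt e q t ** B)"
    have cos: "0 < cos t" "cos t < 1"
      using elim(3) cos_monotone_0_pi[of 0 t] by (auto intro: cos_gt_zero)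
    have detB: "det B \<noteq> 0"
      using B(1) by (simp add: GL_def invertible_det_nz)
    have GL: "tilt e q t ** B \<in> GL"
      using cos detB by (simp add: GL_def invertible_det_nz det_mul det_tilt[OF eq(1,3)])
    then have M: "M \<in> lattices"
      by (simp add: M_def lattices_def)
    have "M \<in> \<U>"
      using GL elim(2) W(2) by (auto simp: M_def)
    have detL: "lattice_det L > 0"
      using detB by (simp add: B lattice_det_lattice_of)
    have detM: "lattice_det M = cos t * lattice_det L"
      using cos by (simp add: M_def B lattice_det_lattice_of[OF GL] lattice_det_lattice_of det_mul
          abs_mult det_tilt[OF eq(1,3)])
    have "min_norm L \<le> min_norm M"
    proof -
      obtain x where x: "x \<in> M" "x \<noteq> 0" "norm x = min_norm M"
        using min_norm_attained[OF M] by blast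
      then obtain y where y: "y \<in> L" "x = tilt e q t *v y"
        by (auto simp: M_def B(2) lattice_of_def matrix_vector_mul_assoc[symmetric])
      then have "y \<noteq> 0"
        using x(2) by auto
      then show ?thesis
        using elim(1) x y by auto
    qed
    define \<omega> where "\<omega> = measure lebesgue (ball (0 :: real^'n) 1) / 2 ^ CARD('n)"
    have \<omega>: "\<omega> > 0"
      using content_ball_pos[of 1 "0 :: real^'n"] by (simp add: \<omega>_def)
    have dens: "packing_density K = \<omega> * (min_norm K ^ CARD('n) / lattice_det K)" for K :: "(real^'n) set"
      by (simp add: packing_density_def \<omega>_def)
    have "min_norm L ^ CARD('n) / lattice_det L < min_norm L ^ CARD('n) / lattice_det M"
      using detM detL cos min_norm_pos[OF assms(1)] by (intro divide_strict_left_mono) auto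
    also have "\<dots> \<le> min_norm M ^ CARD('n) / lattice_det M"
      using \<open>min_norm L \<le> min_norm M\<close> detM detL cos min_norm_pos[OF assms(1)]
      by (intro divide_right_mono power_mono) auto
    finally have "packing_density L < packing_density M"
      unfolding dens using \<omega> by (intro mult_strict_left_mono)
    then show False
      using \<U>(3)[OF \<open>M \<in> \<U>\<close>] by simp
  qed
  then show False
    by simp
qed

section \<open>Weakly nearly orthogonal bases\<close>

text \<open>The infimum bounds each single angle, and cosine decreases from 1/2 at
  \<open>pi / 3\<close>. Applying this to \<open>u\<close> and \<open>- u\<close> gives the absolute
  value.\<close>

lemma subspace_angle_ge_imp_inner_le:
  fixes v :: "real^'n"
  assumes "pi / 3 \<le> subspace_angle v V" "subspace V" "u \<in> V"
  shows "2 * \<bar>v \<bullet> u\<bar> \<le> norm v * norm u"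
proof -
  have bound: "- 1 \<le> x \<bullet> y / (norm x * norm y)" "x \<bullet> y / (norm x * norm y) \<le> 1" for x y :: "real^'n"
    using Cauchy_Schwarz_ineq2[of x y]
    by (auto simp: divide_simps abs_le_iff mult_less_0_iff zero_less_mult_iff)
  have "2 * (v \<bullet> u) \<le> norm v * norm u" if "u \<in> V" for u
  proof (cases "u = 0 \<or> v = 0")
    case False
    have "bdd_below (vector_angle v ` (V - {0}))"
      using bound by (intro bdd_belowI2[of _ 0]) (simp add: vector_angle_def arccos_lbound)
    then have "subspace_angle v V \<le> vector_angle v u"
      unfolding subspace_angle_def using that False by (intro cINF_lower) auto
    then have "arccos (1 / 2) \<le> arccos (v \<bullet> u / (norm v * norm u))"
      using assms(1) arccos_cos[of "pi / 3"] by (simp add: cos_60 vector_angle_def)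
    then have "v \<bullet> u / (norm v * norm u) \<le> 1 / 2"
      using bound[of v u] by (subst (asm) arccos_le_mono) (auto simp: abs_le_iff)
    then show ?thesis
      using False by (simp add: divide_simps)
  qed auto
  from this[of u] this[of "- u"] show ?thesis
    using assms(2,3) by (auto simp: subspace_neg)
qed

text \<open>A minimal vector involving the last basis vector is either a multiple of it or forms an
  equilateral triangle with its two parts \<open>y\<close> and \<open>c b\<^sub>n\<close>. In the second case \<open>y\<close> is, up to a
  factor, the projection of \<open>b\<^sub>n\<close>, hence orthogonal to every vector of the span orthogonal
  to \<open>b\<^sub>n\<close>.\<close>

lemma inner_zero_of_minimal_sum:
  fixes v y q :: "'a::real_inner"
  assumes m: "m > 0" "norm (y + v) = m" "m \<le> norm y" "m \<le> norm v"
    and angle: "\<And>t. 2 * \<bar>v \<bullet> (y + t *\<^sub>R q)\<bar> \<le> norm v * norm (y + t *\<^sub>R q)"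
    and q: "v \<bullet> q = 0"
  shows "y \<bullet> q = 0"
proof -
  have "2 * \<bar>v \<bullet> y\<bar> \<le> norm v * norm y"
    using angle[of 0] by simp
  moreover have sq: "m\<^sup>2 = (norm y)\<^sup>2 + 2 * (v \<bullet> y) + (norm v)\<^sup>2"
    by (simp add: m(2)[symmetric] power2_norm_eq_inner inner_add_left inner_add_right inner_commute)
  ultimately have le: "(norm y)\<^sup>2 + (norm v)\<^sup>2 - norm v * norm y \<le> m\<^sup>2"
    by linarith
  have eq: "norm y = m \<and> norm v = m"
  proof -
    define a b where "a = norm y - m" and "b = norm v - m"
    have "a \<ge> 0" "b \<ge> 0"
      using m by (auto simp: a_def b_def)
    \<comment> \<open>In terms of the excesses over \<open>m\<close> the form is a sum of
      nonnegative terms, so a value of at most 0 forces both excesses to vanish.\<close>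
    moreover have "(norm y)\<^sup>2 + (norm v)\<^sup>2 - norm v * norm y - m\<^sup>2 = (a - b)\<^sup>2 + a * b + m * (a + b)"
      by (simp add: a_def b_def algebra_simps power2_eq_square)
    ultimately have "(a - b)\<^sup>2 + a * b + m * (a + b) \<le> 0" "0 \<le> (a - b)\<^sup>2" "0 \<le> a * b"
      using le by auto
    then have "m * (a + b) \<le> 0"
      by linarith
    then have "a + b \<le> 0"
      using m(1) by (simp add: mult_le_0_iff)
    then show ?thesis
      using \<open>a \<ge> 0\<close> \<open>b \<ge> 0\<close> by (auto simp: a_def b_def)
  qed
  then have vy: "2 * (v \<bullet> y) = - m\<^sup>2"
    using sq by simp
  \<comment> \<open>As \<open>v\<close> is orthogonal to \<open>q\<close>, its inner product with
    \<open>y + t *\<^sub>R q\<close> stays at \<open>- m\<^sup>2 / 2\<close>, and the angle bound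
    becomes a lower bound on the norm. So \<open>y\<close> is a shortest point of this line.\<close>
  have "norm y \<le> norm (y + t *\<^sub>R q)" for t
  proof -
    have "m * m \<le> m * norm (y + t *\<^sub>R q)"
      using angle[of t] vy eq by (simp add: inner_add_right q power2_eq_square)
    then show ?thesis
      using m(1) eq by simp
  qed
  then have "y \<bullet> y \<le> (y + t *\<^sub>R q) \<bullet> (y + t *\<^sub>R q)" for t
    by (simp add: norm_le)
  then have t: "0 \<le> 2 * t * (y \<bullet> q) + t\<^sup>2 * (q \<bullet> q)" for t
    by (simp add: inner_add_left inner_add_right inner_commute power2_eq_square algebra_simps)
  show ?thesis
  proof (cases "q = 0")
    case False
    then have "q \<bullet> q > 0"
      by simp
    then have "0 \<le> - ((y \<bullet> q)\<^sup>2 / (q \<bullet> q))"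
      \<comment> \<open>The minimizer of the quadratic in \<open>t\<close>.\<close>
      using t[of "- (y \<bullet> q) / (q \<bullet> q)"] by (simp add: power2_eq_square)
    then show ?thesis
      using \<open>q \<bullet> q > 0\<close> by (simp add: divide_le_0_iff)
  qed simp
qed

section \<open>Two hyperplanes from the last basis vector\<close>

lemma weakly_nearly_orthogonal_hyperplane_cover:
  fixes L :: "(real^'n) set"
  assumes n: "CARD('n) \<ge> 3" and L: "L \<in> lattices"
    and b: "ordered_basis b L" "weakly_nearly_orthogonal b"
  shows "\<exists>e q. hyperplane_cover e q L"
proof -
  define N where "N = CARD('n)"
  define V where "V = span (b ` {1..N - 1})"
  have basis: "inj_on b {1..N}" "independent (b ` {1..N})"
    and L_eq: "L = {(\<Sum>i=1..N. of_int (c i) *\<^sub>R b i) | c. True}"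
    using b(1) by (auto simp: ordered_basis_def N_def)
  have V: "subspace V"
    by (simp add: V_def)
  have dimV: "dim V = N - 1"
  proof -
    have "independent (b ` {1..N - 1})"
      using basis(2) by (rule independent_mono) auto
    moreover have "inj_on b {1..N - 1}"
      using basis(1) by (rule inj_on_subset) auto
    ultimately show ?thesis
      by (simp add: V_def dim_eq_card_independent card_image)
  qed
  have angle: "2 * \<bar>b N \<bullet> u\<bar> \<le> norm (b N) * norm u" if "u \<in> V" for u
  proof (rule subspace_angle_ge_imp_inner_le[OF _ V that])
    show "pi / 3 \<le> subspace_angle (b N) V"
    proof -
      \<comment> \<open>Index \<open>i\<close> carries the angle of \<open>b (i + 1)\<close>, so the
        angle of \<open>b N\<close> has index \<open>N - 1\<close>.\<close>
      have "N - 1 \<in> {1..CARD('n) - 1}" "N - 1 + 1 = N"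
        using n by (auto simp: N_def)
      then show ?thesis
        using b(2) unfolding weakly_nearly_orthogonal_def V_def by metis
    qed
  qed
  have "dim V \<noteq> dim (UNIV :: (real^'n) set)"
    using dimV n by (simp add: N_def)
  then have "span V \<subset> span UNIV"
    by (metis dim_span psubsetI span_mono subset_UNIV)
  then obtain e0 where e0: "e0 \<noteq> 0" "\<And>y. y \<in> V \<Longrightarrow> e0 \<bullet> y = 0"
    using orthogonal_to_subspace_exists_gen[of V UNIV] unfolding orthogonal_def by (metis span_base)
  obtain p z where p: "p \<in> V" "\<And>w. w \<in> V \<Longrightarrow> z \<bullet> w = 0" "b N = p + z"
    using orthogonal_subspace_decomp_exists[of V "b N"] V by (auto simp: orthogonal_def span_eq_iff[THEN iffD2])
  \<comment> \<open>Here the dimension bound enters: \<open>V\<close> has dimension at least 2,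
    leaving room for \<open>q0\<close> orthogonal to the projection \<open>p\<close> and hence to
    \<open>b N\<close>.\<close>
  have "dim {p} < dim V"
    using dim_le_card'[of "{p}"] n by (simp add: dimV N_def)
  then have "span {p} \<noteq> span V"
    by (metis dim_span order_less_irrefl)
  moreover have "span {p} \<subseteq> span V"
    using p(1) by (intro span_mono) simp
  ultimately have "span {p} \<subset> span V"
    by blast
  then obtain q0 where q0: "q0 \<noteq> 0" "q0 \<in> V" "q0 \<bullet> p = 0"
    using orthogonal_to_subspace_exists_gen[of "{p}" V] V unfolding orthogonal_def
    by (metis insertI1 span_base span_eq_iff)
  have q0b: "b N \<bullet> q0 = 0"
    using p q0 by (simp add: inner_add_left inner_commute[of p q0])
  have cover: "e0 \<bullet> x = 0 \<or> q0 \<bullet> x = 0" if x: "x \<in> min_vectors L" for x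
  proof -
    obtain c where c: "x = (\<Sum>i=1..N. of_int (c i) *\<^sub>R b i)"
      using x by (auto simp: min_vectors_def L_eq)
    define y v where "y = (\<Sum>i=1..N - 1. of_int (c i) *\<^sub>R b i)" and "v = of_int (c N) *\<^sub>R b N"
    have split: "{1..N} = insert N {1..N - 1}" "N \<notin> {1..N - 1}"
      using n by (auto simp: N_def)
    have xyv: "x = y + v"
      unfolding c y_def v_def split(1) using split(2) by (simp add: add.commute)
    have yV: "y \<in> V"
      unfolding y_def V_def by (intro span_sum span_scale span_base imageI)
    have "y = (\<Sum>i=1..N. of_int (if i = N then 0 else c i) *\<^sub>R b i)"
      unfolding split(1) y_def using split(2) by (simp cong: if_cong) (auto intro!: sum.cong)
    then have yL: "y \<in> L"
      unfolding L_eq by (intro CollectI exI conjI TrueI)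
    have "v = (\<Sum>i=1..N. of_int (if i = N then c N else 0) *\<^sub>R b i)"
      unfolding split(1) v_def using split(2) by (auto intro!: sum.neutral[symmetric])
    then have vL: "v \<in> L"
      unfolding L_eq by (intro CollectI exI conjI TrueI)
    show ?thesis
    \<comment> \<open>If \<open>v = 0\<close> then \<open>x\<close> lies in \<open>V\<close>, and if
      \<open>y = 0\<close> it is a multiple of \<open>b N\<close>. Otherwise both are nonzero
      lattice vectors, hence at least as long as \<open>min_norm L\<close>.\<close>
    proof (cases "v = 0 \<or> y = 0")
      case True
      then show ?thesis
        using e0(2)[OF yV] q0b by (auto simp: xyv v_def inner_commute)
    next
      case False
      have "y \<bullet> q0 = 0"
      proof (rule inner_zero_of_minimal_sum)
        show "min_norm L > 0" "min_norm L \<le> norm y" "min_norm L \<le> norm v"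
          using min_norm_pos[OF L] min_norm_le[OF L] yL vL False by auto
        show "norm (y + v) = min_norm L"
          using x by (simp add: min_vectors_def xyv)
        show "v \<bullet> q0 = 0"
          using q0b by (simp add: v_def)
        show "2 * \<bar>v \<bullet> (y + t *\<^sub>R q0)\<bar> \<le> norm v * norm (y + t *\<^sub>R q0)" for t
        proof -
          have "y + t *\<^sub>R q0 \<in> V"
            using V yV q0(2) by (intro subspace_add subspace_scale)
          then have "\<bar>of_int (c N)\<bar> * (2 * \<bar>b N \<bullet> (y + t *\<^sub>R q0)\<bar>)
              \<le> \<bar>of_int (c N)\<bar> * (norm (b N) * norm (y + t *\<^sub>R q0))"
            by (intro mult_left_mono angle) auto
          then show ?thesis
            by (simp add: v_def abs_mult mult_ac del: inner_add_right)
        qed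
      qed
      then show ?thesis
        using q0b by (simp add: xyv v_def inner_add_right inner_commute)
    qed
  qed
  have "hyperplane_cover (e0 /\<^sub>R norm e0) (q0 /\<^sub>R norm q0) L"
    using e0 q0 cover by (auto simp: hyperplane_cover_def)
  then show ?thesis
    by blast
qed

theorem corollary1p4:
  assumes "CARD('n::finite) \<ge> 3"
  shows "(\<forall>\<C>\<in>(WR_classes :: (real^'n) set set set). \<forall>L\<in>\<C>. \<not> perfect L) \<and>
         (\<forall>\<C>\<in>(WR_classes :: (real^'n) set set set). \<forall>L\<in>\<C>. \<not> extreme L)"
proof -
  have "\<not> perfect M \<and> \<not> extreme M" if C: "\<C> \<in> WR_classes" "M \<in> \<C>" for \<C> and M :: "(real^'n) set"
  proof -
    obtain L b where L: "L \<in> lattices" "ordered_basis b L" "weakly_nearly_orthogonal b"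
        "(L, M) \<in> similarity"
      using C by (auto simp: WR_classes_def quotient_def)
    obtain e q where "hyperplane_cover e q L"
      using weakly_nearly_orthogonal_hyperplane_cover[OF assms L(1-3)] by blast
    then obtain e q where "hyperplane_cover e q M"
      using hyperplane_cover_similar L(4) by blast
    moreover have "M \<in> lattices"
      using L(4) by (simp add: similarity_def)
    ultimately show ?thesis
      using hyperplane_cover_not_perfect hyperplane_cover_not_extreme by blast
  qed
  then show ?thesis
    by blast
qed

end
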